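(* Let $n\geq 2$ be an integer, and let $m,q \geq 2$ be integers. Then $n$ has a conjugate $(m,q)$-ary partition if and only if $n$ equals $\chi(M^{s_k}R^{t_k}\cdots M^{s_1}R^{t_1})$ evaluated at $m$ and $q$ for some $k\ge 1$ and some non-negative integers $s_1, t_1, \ldots, s_k, t_k$.
   Context: Let $m,q\ge 2$ be integers. A partition $\lambda$ of a positive integer $n$ is $m$-ary if all its parts are powers $m^i$, $i\ge 0$ (so $m^0=1$ is allowed). If $a_i$ is the number of times the part $m^i$ appears in $\lambda$, one writes $\lambda=(a_k,a_{k-1},\ldots,a_0)_m$, where $a_k\neq 0$ and $a_i=0$ for $i>k$. $\lambda$ is conjugate $(m,q)$-ary if $\lambda$ is $m$-ary and its conjugate $\lambda'$ is $q$-ary; equivalently, $\lambda$ is $m$-ary and each partial sum $\sum_{i=r}^k a_i$, $0\le r\le k$, is a power of $q$ (with $q^0=1$ allowed). For a conjugate $(m,q)$-ary partition $\lambda=(a_k,\ldots,a_0)_m$, define the operators (each producing a conjugate $(m,q)$-ary partition): raise $R(\lambda)=(qa_k,\ldots,qa_0)_m$ and migration $M(\lambda)=(1,a_k-1,a_{k-1},\ldots,a_0)_m$. Sequences of operators are composed as functions (rightmost applied first). Characteristic polynomial: let $A$ be a sequence of $R$ and $M$ operators, and write $A(1)_m=(a_K,\ldots,a_0)_m$, where $(1)_m$ is the trivial partition of $1$. Then $a_K=q^{e_K}$ and $a_i=q^{e_i}-q^{e_{i+1}}$ for $0\le i<K$, for exponents $e_i$ depending only on the sequence $A$. Treating $m$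 and $q$ as independent indeterminates, one sets $$\chi(A)=q^{e_K}m^K+\sum_{i=0}^{K-1}(q^{e_i}-q^{e_{i+1}})m^i\in\mathbb{Z}[m,q].$$ *)

theory Defs
  imports Main "HOL-Library.Multiset" "HOL-Computational_Algebra.Polynomial"
begin

text \<open>A partition of \<open>n\<close> is the finite multiset of its (positive) parts.\<close>

definition is_partition :: "nat \<Rightarrow> nat multiset \<Rightarrow> bool" where
  "is_partition n \<mu> \<longleftrightarrow> 0 \<notin># \<mu> \<and> sum_mset \<mu> = n"

text \<open>The parts of the conjugate are the column lengths \<open>\<mu>'\<^sub>j = #{parts of \<mu> that are \<ge> j}\<close>,
  for \<open>j\<close> from 1 up to the largest part.\<close>

definition conj_partition :: "nat multiset \<Rightarrow> nat multiset" where
  "conj_partition \<mu> =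
     image_mset (\<lambda>j. size {#x \<in># \<mu>. j \<le> x#}) (mset_set {j. 1 \<le> j \<and> (\<exists>x\<in>#\<mu>. j \<le> x)})"

definition ary :: "nat \<Rightarrow> nat multiset \<Rightarrow> bool" where
  "ary m \<mu> \<longleftrightarrow> (\<forall>x\<in>#\<mu>. \<exists>i. x = m ^ i)"

definition conjugate_ary :: "nat \<Rightarrow> nat \<Rightarrow> nat multiset \<Rightarrow> bool" where
  "conjugate_ary m q \<mu> \<longleftrightarrow> ary m \<mu> \<and> ary q (conj_partition \<mu>)"

text \<open>The notation \<open>(a\<^sub>k, \<dots>, a\<^sub>0)\<^sub>m\<close>: \<open>mpart m k a\<close> is the partition in which \<open>m\<^sup>i\<close>
  occurs \<open>a i\<close> times (\<open>i \<le> k\<close>). Conversely, \<open>part_mult m \<mu> i\<close> and \<open>top_index m \<mu>\<close> read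
  off \<open>a\<^sub>i\<close> and \<open>k\<close> from a nonempty \<open>m\<close>-ary partition.\<close>

definition mpart :: "nat \<Rightarrow> nat \<Rightarrow> (nat \<Rightarrow> nat) \<Rightarrow> nat multiset" where
  "mpart m k a = (\<Sum>i\<le>k. replicate_mset (a i) (m ^ i))"

definition part_mult :: "nat \<Rightarrow> nat multiset \<Rightarrow> nat \<Rightarrow> nat" where
  "part_mult m \<mu> i = count \<mu> (m ^ i)"

definition top_index :: "nat \<Rightarrow> nat multiset \<Rightarrow> nat" where
  "top_index m \<mu> = (GREATEST i. part_mult m \<mu> i \<noteq> 0)"

definition raise :: "nat \<Rightarrow> nat \<Rightarrow> nat multiset \<Rightarrow> nat multiset" where
  "raise m q \<mu> = mpart m (top_index m \<mu>) (\<lambda>i. q * part_mult m \<mu> i)"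

definition migrate :: "nat \<Rightarrow> nat multiset \<Rightarrow> nat multiset" where
  "migrate m \<mu> =
     (let k = top_index m \<mu>; a = part_mult m \<mu>
      in mpart m (Suc k) (a(k := a k - 1, Suc k := 1)))"

text \<open>Formal words in the operators; the letter at the end of the list acts first.\<close>

datatype part_op = Raise | Migrate

primrec apply_op :: "nat \<Rightarrow> nat \<Rightarrow> part_op \<Rightarrow> nat multiset \<Rightarrow> nat multiset" where
  "apply_op m q Raise = raise m q"
| "apply_op m q Migrate = migrate m"

definition apply_ops :: "nat \<Rightarrow> nat \<Rightarrow> part_op list \<Rightarrow> nat multiset \<Rightarrow> nat multiset" where
  "apply_ops m q A = foldr (apply_op m q) A"

text \<open>\<open>es = [e\<^sub>0, \<dots>, e\<^sub>K]\<close> is the list of exponents of \<open>A\<close>, with the lowest index first.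
  The multiplicities are compared in \<open>int\<close> so that subtraction is not truncated, and the same
  \<open>es\<close> has to work for all \<open>m\<close> and \<open>q\<close>. Existence and uniqueness are shown in
  \<open>ex1_is_exponents\<close> below.\<close>

definition is_exponents :: "part_op list \<Rightarrow> nat list \<Rightarrow> bool" where
  "is_exponents A es \<longleftrightarrow>
     (\<forall>m\<ge>2. \<forall>q\<ge>2.
        let \<mu> = apply_ops m q A {#1#}; K = top_index m \<mu> in
          length es = Suc K \<and>
          part_mult m \<mu> K = q ^ (es ! K) \<and>
          (\<forall>i<K. int (part_mult m \<mu> i) = int q ^ (es ! i) - int q ^ (es ! Suc i)))"

definition exponents :: "part_op list \<Rightarrow> nat list" where
  "exponents A = (THE es. is_exponents A es)"

text \<open>\<open>\<int>[m,q]\<close> is represented as \<open>\<int>[q][m]\<close>: the outer indeterminate is \<open>m\<close>, the inner one is \<open>q\<close>.\<close>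

definition chi :: "part_op list \<Rightarrow> int poly poly" where
  "chi A =
     (let es = exponents A; K = length es - 1 in
        monom (monom 1 (es ! K)) K +
        (\<Sum>i<K. monom (monom 1 (es ! i) - monom 1 (es ! Suc i)) i))"

definition eval_mq :: "int poly poly \<Rightarrow> int \<Rightarrow> int \<Rightarrow> int" where
  "eval_mq p m q = poly (poly p [:m:]) q"

text \<open>The word \<open>M^(s k) R^(t k) \<cdots> M^(s 1) R^(t 1)\<close>.\<close>

definition MR_word :: "nat \<Rightarrow> (nat \<Rightarrow> nat) \<Rightarrow> (nat \<Rightarrow> nat) \<Rightarrow> part_op list" where
  "MR_word k s t = concat (map (\<lambda>i. replicate (s i) Migrate @ replicate (t i) Raise) (rev [1..<Suc k]))"

lemma part_mult_mpart:
  assumes "m \<ge> 2"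
  shows "part_mult m (mpart m k a) i = (if i \<le> k then a i else 0)"
proof -
  have "part_mult m (mpart m k a) i = (\<Sum>j\<le>k. if j = i then a j else 0)"
    using assms unfolding part_mult_def mpart_def count_sum
    by (intro sum.cong) auto
  then show ?thesis by simp
qed

lemma top_index_mpart:
  assumes "m \<ge> 2" "a k \<noteq> 0"
  shows "top_index m (mpart m k a) = k"
  unfolding top_index_def using assms
  by (intro Greatest_equality) (auto simp: part_mult_mpart split: if_splits)

lemma ex_is_exponents: "\<exists>es. is_exponents A es \<and> sorted_wrt (\<ge>) es"
proof (induction A)
  case Nil
  have one: "{#1::nat#} = mpart m 0 (\<lambda>_. 1)" for m by (simp add: mpart_def)
  have "top_index m {#1#} = 0" "part_mult m {#1#} 0 = 1" if "m \<ge> 2" for m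
    using that by (simp_all only: one[of m] top_index_mpart part_mult_mpart) simp_all
  then have "is_exponents [] [0]"
    by (simp add: is_exponents_def apply_ops_def Let_def)
  then show ?case by (intro exI[of _ "[0]"]) simp
next
  case (Cons x A)
  then obtain es where es: "is_exponents A es" and sorted: "sorted_wrt (\<ge>) es" by blast
  show ?case
  proof (cases x)
    case Raise
    have "is_exponents (x # A) (map Suc es)"
      unfolding is_exponents_def Let_def
    proof (intro allI impI)
      fix m q :: nat assume mq: "m \<ge> 2" "q \<ge> 2"
      define \<mu> where "\<mu> = apply_ops m q A {#1#}"
      define K where "K = top_index m \<mu>"
      have h: "length es = Suc K" "part_mult m \<mu> K = q ^ (es ! K)"
        "\<forall>i<K. int (part_mult m \<mu> i) = int q ^ (es ! i) - int q ^ (es ! Suc i)"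
        using es mq unfolding is_exponents_def Let_def \<mu>_def K_def by blast+
      have \<mu>': "apply_ops m q (x # A) {#1#} = mpart m K (\<lambda>i. q * part_mult m \<mu> i)"
        by (simp add: apply_ops_def Raise raise_def \<mu>_def K_def)
      have top: "top_index m (mpart m K (\<lambda>i. q * part_mult m \<mu> i)) = K"
        using mq h by (intro top_index_mpart) auto
      show "length (map Suc es) = Suc (top_index m (apply_ops m q (x # A) {#1#})) \<and>
        part_mult m (apply_ops m q (x # A) {#1#}) (top_index m (apply_ops m q (x # A) {#1#})) =
          q ^ (map Suc es ! top_index m (apply_ops m q (x # A) {#1#})) \<and>
        (\<forall>i<top_index m (apply_ops m q (x # A) {#1#}).
           int (part_mult m (apply_ops m q (x # A) {#1#}) i) =
             int q ^ (map Suc es ! i) - int q ^ (map Suc es ! Suc i))"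
        unfolding \<mu>' top using mq h by (simp add: part_mult_mpart right_diff_distrib)
    qed
    moreover have "sorted_wrt (\<ge>) (map Suc es)"
      using sorted by (simp add: sorted_wrt_map)
    ultimately show ?thesis by blast
  next
    case Migrate
    have "is_exponents (x # A) (es @ [0])"
      unfolding is_exponents_def Let_def
    proof (intro allI impI)
      fix m q :: nat assume mq: "m \<ge> 2" "q \<ge> 2"
      define \<mu> where "\<mu> = apply_ops m q A {#1#}"
      define K where "K = top_index m \<mu>"
      define a where "a = (part_mult m \<mu>)(K := part_mult m \<mu> K - 1, Suc K := 1)"
      have h: "length es = Suc K" "part_mult m \<mu> K = q ^ (es ! K)"
        "\<forall>i<K. int (part_mult m \<mu> i) = int q ^ (es ! i) - int q ^ (es ! Suc i)"
        using es mq unfolding is_exponents_def Let_def \<mu>_def K_def by blast+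
      have \<mu>': "apply_ops m q (x # A) {#1#} = mpart m (Suc K) a"
        by (simp add: apply_ops_def Migrate migrate_def Let_def \<mu>_def K_def a_def)
      have top: "top_index m (mpart m (Suc K) a) = Suc K"
        using mq by (intro top_index_mpart) (auto simp: a_def)
      have "q ^ (es ! K) \<ge> 1" using mq by simp
      then have "int (a i) = int q ^ ((es @ [0]) ! i) - int q ^ ((es @ [0]) ! Suc i)" if "i < Suc K" for i
        using that h by (auto simp: a_def nth_append less_Suc_eq of_nat_diff)
      then show "length (es @ [0]) = Suc (top_index m (apply_ops m q (x # A) {#1#})) \<and>
        part_mult m (apply_ops m q (x # A) {#1#}) (top_index m (apply_ops m q (x # A) {#1#})) =
          q ^ ((es @ [0]) ! top_index m (apply_ops m q (x # A) {#1#})) \<and>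
        (\<forall>i<top_index m (apply_ops m q (x # A) {#1#}).
           int (part_mult m (apply_ops m q (x # A) {#1#}) i) =
             int q ^ ((es @ [0]) ! i) - int q ^ ((es @ [0]) ! Suc i))"
        unfolding \<mu>' top using mq h by (simp add: part_mult_mpart nth_append) (simp add: a_def)
    qed
    moreover have "sorted_wrt (\<ge>) (es @ [0])"
      using sorted by (simp add: sorted_wrt_append)
    ultimately show ?thesis by blast
  qed
qed

lemma is_exponents_unique:
  assumes "is_exponents A es" "is_exponents A fs"
  shows "es = fs"
proof -
  define \<mu> where "\<mu> = apply_ops 2 2 A {#1#}"
  define K where "K = top_index 2 \<mu>"
  have e: "length es = Suc K" "part_mult 2 \<mu> K = 2 ^ (es ! K)"
    "\<forall>i<K. int (part_mult 2 \<mu> i) = 2 ^ (es ! i) - 2 ^ (es ! Suc i)"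
    using assms(1)[unfolded is_exponents_def Let_def, rule_format, of 2 2] by (simp_all add: \<mu>_def K_def)
  have f: "length fs = Suc K" "part_mult 2 \<mu> K = 2 ^ (fs ! K)"
    "\<forall>i<K. int (part_mult 2 \<mu> i) = 2 ^ (fs ! i) - 2 ^ (fs ! Suc i)"
    using assms(2)[unfolded is_exponents_def Let_def, rule_format, of 2 2] by (simp_all add: \<mu>_def K_def)
  have "es ! i = fs ! i" if "i \<le> K" for i
    using that
  proof (induction i rule: inc_induct)
    case base
    then show ?case using e(2) f(2) by simp
  next
    case (step i)
    then have "(2::int) ^ (es ! i) = 2 ^ (fs ! i)" using e(3) f(3) by force
    then show ?case by simp
  qed
  then show ?thesis using e(1) f(1) by (intro nth_equalityI) auto
qed

theorem ex1_is_exponents: "\<exists>!es. is_exponents A es"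
  using ex_is_exponents is_exponents_unique by blast

end

theory Submission
  imports Defs
begin

text \<open>The columns of an \<open>m\<close>-ary partition have constant length between consecutive powers of
  \<open>m\<close>, so the parts of its conjugate are the numbers of parts that are at least \<open>m\<^sup>r\<close>, that is,
  the partial sums \<open>a\<^sub>r + \<dots> + a\<^sub>k\<close> (\<open>conjugate_ary_iff_heights\<close>). These decrease
  with \<open>r\<close>. A conjugate \<open>(m, q)\<close>-ary partition is therefore the same thing as a nonempty
  nonincreasing list of exponents \<open>e\<^sub>0 \<ge> \<dots> \<ge> e\<^sub>K\<close>, whose \<open>r\<close>-th partial sum is
  \<open>q\<close> to the power \<open>e\<^sub>r\<close> (\<open>conjugate_ary_staircase\<close> and
  \<open>staircase_of_conjugate_ary\<close>).

  On such lists the operators become very simple: raising adds \<open>1\<close> to every exponent, and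
  migration appends a \<open>0\<close>. Neither operation mentions \<open>m\<close> or \<open>q\<close>, so the list that a
  word produces from the trivial partition is its exponent sequence
  (\<open>exponents_word_exps\<close>), and \<open>\<chi>\<close> evaluated at \<open>m\<close> and \<open>q\<close> is the sum of the
  parts of the partition that the word produces (\<open>eval_chi\<close>).

  It remains to see that every nonempty nonincreasing list arises from a word. If \<open>x\<close> is the last
  entry, then subtracting \<open>x\<close> everywhere leaves a list that ends in \<open>0\<close>, and that \<open>0\<close>
  is the trace of a migration; undo the raises and the migration and use induction on the length
  (\<open>word_exps_surj\<close>). Finally, a block may consist of a single letter, because the exponents
  \<open>s\<^sub>i\<close> and \<open>t\<^sub>i\<close> may vanish, so every word has the form required in the theorem
  (\<open>MR_word_surj\<close>).\<close>

section \<open>Heights and staircases\<close>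

definition staircase_mult :: "nat \<Rightarrow> nat list \<Rightarrow> nat \<Rightarrow> nat" where
  "staircase_mult q es i =
     (if Suc i < length es then q ^ (es ! i) - q ^ (es ! Suc i) else q ^ (es ! i))"

text \<open>The conjugate \<open>(m, q)\<close>-ary partition with exponent sequence \<open>es\<close>, lowest index first.
  It has this meaning only for nonempty nonincreasing \<open>es\<close>: there is no last exponent in an empty
  list, and the differences in \<^const>\<open>staircase_mult\<close> are truncated if an exponent increases.\<close>

definition staircase :: "nat \<Rightarrow> nat \<Rightarrow> nat list \<Rightarrow> nat multiset" where
  "staircase m q es = mpart m (length es - 1) (staircase_mult q es)"

text \<open>For \<open>m\<close>-ary partitions this is the partial sum \<open>a\<^sub>r + \<dots> + a\<^sub>k\<close> of the multiplicities,
  read off as a column length of the diagram. It makes sense without reference to \<open>k\<close> and is \<open>0\<close> for large \<open>r\<close>.\<close>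

definition height :: "nat \<Rightarrow> nat multiset \<Rightarrow> nat \<Rightarrow> nat" where
  "height m \<mu> r = size {#x \<in># \<mu>. m ^ r \<le> x#}"

lemma mpart_cong: "(\<And>i. i \<le> k \<Longrightarrow> a i = b i) \<Longrightarrow> mpart m k a = mpart m k b"
  by (simp add: mpart_def)

lemma ary_mpart: "ary m (mpart m k a)"
  by (auto simp: ary_def mpart_def set_mset_sum)

lemma ary_staircase: "ary m (staircase m q es)"
  by (simp add: staircase_def ary_mpart)

lemma ary_elem:
  assumes "ary m \<mu>" "x \<in># \<mu>"
  obtains i where "x = m ^ i"
  using assms unfolding ary_def by blast

lemma height_eq_0_iff: "height m \<mu> r = 0 \<longleftrightarrow> (\<forall>x\<in>#\<mu>. x < m ^ r)"
  by (auto simp: height_def not_le)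

lemma sum_mset_mpart: "\<Sum>\<^sub># (mpart m k a) = (\<Sum>i\<le>k. a i * m ^ i)"
  unfolding mpart_def by (induction k) (simp_all add: sum_mset_replicate_mset)

lemma zero_notin_ary: "ary m \<mu> \<Longrightarrow> m \<ge> 2 \<Longrightarrow> 0 \<notin># \<mu>"
  unfolding ary_def by force

lemma count_staircase:
  assumes "m \<ge> 2" "es \<noteq> []"
  shows "count (staircase m q es) (m ^ i) = (if i < length es then staircase_mult q es i else 0)"
  using part_mult_mpart[OF assms(1), of "length es - 1" "staircase_mult q es" i] assms(2)
  by (cases es) (auto simp: staircase_def part_mult_def)

text \<open>No power of \<open>m\<close> lies strictly between two consecutive ones. The recursion lets heights and
  multiplicities determine each other.\<close>

lemma height_rec:
  assumes "ary m \<mu>" "m \<ge> 2"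
  shows "height m \<mu> r = count \<mu> (m ^ r) + height m \<mu> (Suc r)"
proof -
  have "m ^ r \<le> x \<longleftrightarrow> x = m ^ r \<or> m ^ Suc r \<le> x" if x: "x \<in># \<mu>" for x
  proof -
    obtain i where "x = m ^ i" using assms(1) x by (rule ary_elem)
    then show ?thesis using assms(2) power_increasing_iff[of m] by (auto simp del: power_Suc)
  qed
  then have "{#x \<in># \<mu>. m ^ r \<le> x#} = {#x \<in># \<mu>. x = m ^ r \<or> m ^ Suc r \<le> x#}"
    by (intro filter_mset_cong) auto
  also have "\<dots> = {#x \<in># \<mu>. x = m ^ r#} + {#x \<in># \<mu>. m ^ Suc r \<le> x#}"
  proof (rule multiset_eqI)
    fix x
    have "m ^ r < m ^ Suc r" using assms(2) by simp
    then show "count {#x \<in># \<mu>. x = m ^ r \<or> m ^ Suc r \<le> x#} x =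
        count ({#x \<in># \<mu>. x = m ^ r#} + {#x \<in># \<mu>. m ^ Suc r \<le> x#}) x"
      by (auto simp del: power_Suc)
  qed
  finally show ?thesis
    by (simp add: height_def filter_eq_replicate_mset del: power_Suc)
qed

text \<open>Among powers of \<open>m\<close>, being at least \<open>j\<close> amounts to being at least the first power of
  \<open>m\<close> that reaches \<open>j\<close>. So each column length is already the length of a column whose index
  is a power of \<open>m\<close>.\<close>

lemma conjugate_ary_iff_heights:
  assumes "m \<ge> 2"
  shows "conjugate_ary m q \<mu> \<longleftrightarrow>
    ary m \<mu> \<and> (\<forall>r. (\<exists>x\<in>#\<mu>. m ^ r \<le> x) \<longrightarrow> (\<exists>e. height m \<mu> r = q ^ e))"
proof (cases "ary m \<mu>")
  case True
  have fin: "finite {j. 1 \<le> j \<and> (\<exists>x\<in>#\<mu>. j \<le> x)}"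
    by (rule finite_subset[of _ "\<Union>x\<in>set_mset \<mu>. {..x}"]) auto
  have cols: "ary q (conj_partition \<mu>) \<longleftrightarrow>
      (\<forall>j\<ge>1. (\<exists>x\<in>#\<mu>. j \<le> x) \<longrightarrow> (\<exists>e. size {#x \<in># \<mu>. j \<le> x#} = q ^ e))"
    using fin by (auto simp: ary_def conj_partition_def)
  have "\<exists>e. size {#x \<in># \<mu>. j \<le> x#} = q ^ e"
    if H: "\<forall>r. (\<exists>x\<in>#\<mu>. m ^ r \<le> x) \<longrightarrow> (\<exists>e. height m \<mu> r = q ^ e)"
      and ex: "\<exists>x\<in>#\<mu>. j \<le> x" for j
  proof -
    \<comment> \<open>The columns \<open>j\<close> and \<open>m\<^sup>r\<close> have the same length.\<close>
    define r where "r = (LEAST r. j \<le> m ^ r)"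
    have eq: "j \<le> x \<longleftrightarrow> m ^ r \<le> x" if x: "x \<in># \<mu>" for x
    proof -
      obtain i where i: "x = m ^ i" using True x by (rule ary_elem)
      have "r \<le> i" if "j \<le> m ^ i" unfolding r_def using that by (rule Least_le)
      moreover have "j \<le> m ^ r"
      proof -
        from ex True obtain k where "j \<le> m ^ k" by (metis ary_elem)
        then show ?thesis unfolding r_def by (rule LeastI)
      qed
      ultimately show ?thesis
        using assms i by (auto intro: order.trans power_increasing)
    qed
    have "{#x \<in># \<mu>. j \<le> x#} = {#x \<in># \<mu>. m ^ r \<le> x#}"
      using eq by (intro filter_mset_cong) auto
    then show ?thesis using H eq ex unfolding height_def by auto
  qed
  moreover have "1 \<le> m ^ r" for r using assms by simp
  ultimately show ?thesis
    using True unfolding conjugate_ary_def cols height_def by blast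
qed (simp add: conjugate_ary_def)

lemma height_staircase_above:
  assumes "m \<ge> 2" "es \<noteq> []" "length es \<le> r"
  shows "height m (staircase m q es) r = 0"
  unfolding height_eq_0_iff
proof
  fix x assume x: "x \<in># staircase m q es"
  with ary_staircase obtain i where i: "x = m ^ i" by (rule ary_elem)
  with x have "i < length es"
    using count_staircase[OF assms(1,2), of q i]
    by (auto simp flip: count_greater_zero_iff split: if_splits)
  then show "x < m ^ r" using i assms(1,3) by simp
qed

text \<open>The differences in \<^const>\<open>staircase_mult\<close> telescope, starting from the top index.\<close>

lemma height_staircase:
  assumes "m \<ge> 2" "q \<ge> 2" "sorted_wrt (\<ge>) es" "es \<noteq> []"
  shows "height m (staircase m q es) r = (if r < length es then q ^ (es ! r) else 0)"
proof (cases "r < length es")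
  case False
  then show ?thesis using height_staircase_above[OF assms(1,4)] by simp
next
  case True
  then have "r \<le> length es - 1" by simp
  then have "height m (staircase m q es) r = q ^ (es ! r)"
  proof (induction r rule: inc_induct)
    case base
    show ?case
      using assms height_rec[OF ary_staircase, of m q es "length es - 1"]
        height_staircase_above[OF assms(1,4), of "length es" q]
      by (simp add: count_staircase staircase_mult_def)
  next
    case (step r)
    then have "Suc r < length es" by simp
    then have "es ! Suc r \<le> es ! r" using assms(3) by (simp add: sorted_wrt_iff_nth_less)
    then have "q ^ (es ! Suc r) \<le> q ^ (es ! r)" using assms(2) by (simp add: power_increasing)
    then show ?case using \<open>Suc r < length es\<close> step.IH assms height_rec[OF ary_staircase, of m q es r]
      by (simp add: count_staircase staircase_mult_def)
  qed
  then show ?thesis using True by simp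
qed

lemma conjugate_ary_staircase:
  assumes "m \<ge> 2" "q \<ge> 2" "sorted_wrt (\<ge>) es" "es \<noteq> []"
  shows "conjugate_ary m q (staircase m q es)"
proof -
  have "r < length es" if "x \<in># staircase m q es" "m ^ r \<le> x" for r x
    using height_staircase_above[OF assms(1,4), of r q] that
    by (meson height_eq_0_iff leD leI)
  then show ?thesis
    unfolding conjugate_ary_iff_heights[OF assms(1)]
    using ary_staircase height_staircase[OF assms] by auto
qed

text \<open>The exponents of the heights form the list \<open>es\<close>. They determine \<open>\<mu>\<close>, because the
  multiplicity of \<open>m\<^sup>i\<close> is the difference of two consecutive heights.\<close>

lemma staircase_of_conjugate_ary:
  assumes "m \<ge> 2" "q \<ge> 2" "conjugate_ary m q \<mu>" "\<mu> \<noteq> {#}"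
  obtains es where "es \<noteq> []" "sorted_wrt (\<ge>) es" "\<mu> = staircase m q es"
proof -
  note heights = assms(3)[unfolded conjugate_ary_iff_heights[OF assms(1)]]
  then have ary: "ary m \<mu>" by blast
  have "Max (set_mset \<mu>) \<in># \<mu>" using assms(4) by simp
  with ary obtain K where K: "Max (set_mset \<mu>) = m ^ K" unfolding ary_def by blast
  have top: "m ^ K \<in># \<mu>" using K \<open>Max (set_mset \<mu>) \<in># \<mu>\<close> by simp
  have le_top: "x \<le> m ^ K" if "x \<in># \<mu>" for x using K that by (metis Max_ge finite_set_mset)
  have "\<exists>e. height m \<mu> r = q ^ e" if "r \<le> K" for r
    using heights top that assms(1) by (meson power_increasing order.trans one_le_numeral)
  then obtain e where e: "\<And>r. r \<le> K \<Longrightarrow> height m \<mu> r = q ^ e r" by metis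
  define es where "es = map e [0..<Suc K]"
  have len: "length es = Suc K" and nth: "\<And>r. r \<le> K \<Longrightarrow> es ! r = e r"
    by (simp_all add: es_def del: upt_Suc)
  have ne: "es \<noteq> []" using len by auto
  have above: "height m \<mu> r = 0" if "K < r" for r
  proof -
    have "m ^ K < m ^ r" using assms(1) that by simp
    then show ?thesis using le_top height_eq_0_iff le_less_trans by blast
  qed
  have "e j \<le> e i" if "i < j" "j \<le> K" for i j
  proof -
    have "height m \<mu> (Suc r) \<le> height m \<mu> r" for r
      using height_rec[OF ary assms(1), of r] by simp
    then have "height m \<mu> j \<le> height m \<mu> i"
      using less_imp_le[OF that(1)] by (rule lift_Suc_antimono_le)
    then show ?thesis using e that assms(2) by (simp add: power_increasing_iff)
  qed
  then have sorted: "sorted_wrt (\<ge>) es"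
    by (auto simp: sorted_wrt_iff_nth_less len nth)
  have ht: "height m \<mu> r = height m (staircase m q es) r" for r
    using height_staircase[OF assms(1,2) sorted ne] e above len nth by (cases "r \<le> K") auto
  have "\<mu> = staircase m q es"
  proof (rule multiset_eqI)
    fix x
    show "count \<mu> x = count (staircase m q es) x"
    proof (cases "\<exists>i. x = m ^ i")
      case True
      then obtain i where "x = m ^ i" by blast
      moreover have "count \<mu> (m ^ i) = count (staircase m q es) (m ^ i)"
        using height_rec[OF ary assms(1), of i]
          height_rec[OF ary_staircase assms(1), of q es i] ht[of i] ht[of "Suc i"] by linarith
      ultimately show ?thesis by simp
    next
      case False
      then have "x \<notin># \<mu>" "x \<notin># staircase m q es"
        using ary ary_staircase[of m q es] by (auto simp: ary_def)
      then show ?thesis by (simp add: not_in_iff)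
    qed
  qed
  with ne sorted that show ?thesis by blast
qed

section \<open>The operators on exponent sequences\<close>

primrec word_exps :: "part_op list \<Rightarrow> nat list" where
  "word_exps [] = [0]"
| "word_exps (x # A) =
     (case x of Raise \<Rightarrow> map Suc (word_exps A) | Migrate \<Rightarrow> word_exps A @ [0])"

lemma word_exps_nonempty: "word_exps A \<noteq> []"
  by (induction A) (auto split: part_op.split)

lemma sorted_word_exps: "sorted_wrt (\<ge>) (word_exps A)"
  by (induction A) (auto simp: sorted_wrt_append sorted_wrt_map split: part_op.split)

lemma top_index_staircase:
  assumes "m \<ge> 2" "q \<ge> 2" "es \<noteq> []"
  shows "top_index m (staircase m q es) = length es - 1"
  using assms unfolding staircase_def
  by (intro top_index_mpart) (auto simp: staircase_mult_def)

text \<open>Multiplying all multiplicities by \<open>q\<close> multiplies all heights by \<open>q\<close>, which increases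
  every exponent by \<open>1\<close>.\<close>

lemma raise_staircase:
  assumes "m \<ge> 2" "q \<ge> 2" "es \<noteq> []"
  shows "raise m q (staircase m q es) = staircase m q (map Suc es)"
  unfolding raise_def top_index_staircase[OF assms] staircase_def[of m q "map Suc es"] length_map
  using assms by (intro mpart_cong)
    (auto simp: part_mult_def count_staircase staircase_mult_def diff_mult_distrib2 Suc_le_eq
      simp flip: length_greater_0_conv)

text \<open>Migration moves one of the largest parts up to the next power of \<open>m\<close>, so the old heights stay
  and a height \<open>1 = q\<^sup>0\<close> is added above them.\<close>

lemma migrate_staircase:
  assumes "m \<ge> 2" "q \<ge> 2" "es \<noteq> []"
  shows "migrate m (staircase m q es) = staircase m q (es @ [0])"
proof -
  obtain K where K: "length es = Suc K" using assms(3) by (cases es) auto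
  then show ?thesis
    unfolding migrate_def Let_def top_index_staircase[OF assms] staircase_def[of m q "es @ [0]"]
    using assms
    by (auto intro!: mpart_cong
        simp: part_mult_def count_staircase staircase_mult_def nth_append less_Suc_eq)
qed

text \<open>All dependence on \<open>m\<close> and \<open>q\<close> is in \<^const>\<open>staircase\<close>; the list depends on the word
  alone, as the definition of the exponents demands.\<close>

lemma apply_ops_staircase:
  assumes "m \<ge> 2" "q \<ge> 2"
  shows "apply_ops m q A {#1#} = staircase m q (word_exps A)"
proof (induction A)
  case Nil
  then show ?case by (simp add: apply_ops_def staircase_def mpart_def staircase_mult_def)
next
  case (Cons x A)
  then show ?case
    using raise_staircase[OF assms word_exps_nonempty] migrate_staircase[OF assms word_exps_nonempty]
    by (cases x) (simp_all add: apply_ops_def)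
qed

lemma int_staircase_mult:
  assumes "q \<ge> 2" "sorted_wrt (\<ge>) es" "Suc i < length es"
  shows "int (staircase_mult q es i) = int q ^ (es ! i) - int q ^ (es ! Suc i)"
proof -
  have "es ! Suc i \<le> es ! i" using assms by (simp add: sorted_wrt_iff_nth_less)
  then have "q ^ (es ! Suc i) \<le> q ^ (es ! i)" using assms(1) by (simp add: power_increasing)
  then show ?thesis using assms by (simp add: staircase_mult_def of_nat_diff)
qed

lemma exponents_word_exps: "exponents A = word_exps A"
proof -
  have "is_exponents A (word_exps A)"
    unfolding is_exponents_def Let_def
  proof (intro allI impI)
    fix m q :: nat assume mq: "m \<ge> 2" "q \<ge> 2"
    obtain K where K: "length (word_exps A) = Suc K"
      using word_exps_nonempty[of A] by (cases "word_exps A") auto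
    then have "top_index m (apply_ops m q A {#1#}) = K"
      unfolding apply_ops_staircase[OF mq]
      by (simp add: top_index_staircase[OF mq word_exps_nonempty])
    then show "length (word_exps A) = Suc (top_index m (apply_ops m q A {#1#})) \<and>
       part_mult m (apply_ops m q A {#1#}) (top_index m (apply_ops m q A {#1#})) =
         q ^ (word_exps A ! top_index m (apply_ops m q A {#1#})) \<and>
       (\<forall>i<top_index m (apply_ops m q A {#1#}).
          int (part_mult m (apply_ops m q A {#1#}) i) =
            int q ^ (word_exps A ! i) - int q ^ (word_exps A ! Suc i))"
      using mq K int_staircase_mult[OF mq(2) sorted_word_exps[of A]]
      unfolding apply_ops_staircase[OF mq]
      by (simp add: part_mult_def count_staircase word_exps_nonempty)
        (simp add: staircase_mult_def)
  qed
  then show ?thesis unfolding exponents_def by (intro the1_equality ex1_is_exponents)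
qed

text \<open>The characteristic polynomial is written exactly as the sum \<open>\<Sum>\<^sub>i a\<^sub>i m\<^sup>i\<close> of the parts.\<close>

lemma eval_chi:
  assumes "m \<ge> 2" "q \<ge> 2"
  shows "eval_mq (chi A) (int m) (int q) = int (\<Sum>\<^sub># (staircase m q (word_exps A)))"
proof -
  define es where "es = word_exps A"
  obtain K where K: "length es = Suc K"
    using word_exps_nonempty[of A] by (cases es) (auto simp: es_def)
  have "eval_mq (chi A) (int m) (int q) = int q ^ (es ! K) * int m ^ K
      + (\<Sum>i<K. (int q ^ (es ! i) - int q ^ (es ! Suc i)) * int m ^ i)"
    using K by (simp add: eval_mq_def chi_def Let_def exponents_word_exps poly_sum poly_monom
        flip: es_def)
  also have "(\<Sum>i<K. (int q ^ (es ! i) - int q ^ (es ! Suc i)) * int m ^ i) =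
      (\<Sum>i<K. int (staircase_mult q es i) * int m ^ i)"
    using K int_staircase_mult[OF assms(2) sorted_word_exps[of A]]
    by (intro sum.cong) (simp_all add: es_def)
  also have "int q ^ (es ! K) = int (staircase_mult q es K)"
    using K by (simp add: staircase_mult_def)
  finally show ?thesis
    using K by (simp add: staircase_def sum_mset_mpart lessThan_Suc_atMost[symmetric]
        flip: es_def)
qed

lemma word_exps_raises: "word_exps (replicate t Raise @ A) = map ((+) t) (word_exps A)"
  by (induction t) (simp_all add: map_idI)

text \<open>With \<open>x\<close> the last entry, the word is \<open>R\<^sup>x\<close> if there is no other entry, and otherwise
  \<open>R\<^sup>x M A\<close>, where \<open>A\<close> produces the other entries lowered by \<open>x\<close>. Monotonicity is what makes this lowering reversible.\<close>

lemma word_exps_surj: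
  assumes "es \<noteq> []" "sorted_wrt (\<ge>) es"
  shows "\<exists>A. word_exps A = es"
  using assms
proof (induction es rule: length_induct)
  case (1 es)
  define fs x where "fs = butlast es" and "x = last es"
  have es: "es = fs @ [x]" using "1.prems"(1) by (simp add: fs_def x_def)
  show ?case
  proof (cases "fs = []")
    case True
    have "word_exps (replicate x Raise) = es"
      using word_exps_raises[of x "[]"] es True by simp
    then show ?thesis by blast
  next
    case False
    have ge: "\<forall>f\<in>set fs. x \<le> f" and "sorted_wrt (\<ge>) fs"
      using "1.prems"(2) by (simp_all add: es sorted_wrt_append)
    then have "sorted_wrt (\<ge>) (map (\<lambda>f. f - x) fs)"
      by (auto simp: sorted_wrt_map intro: sorted_wrt_mono_rel[rotated] diff_le_mono)
    moreover have "length (map (\<lambda>f. f - x) fs) < length es" by (simp add: es)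
    ultimately obtain A where A: "word_exps A = map (\<lambda>f. f - x) fs"
      using "1.IH" False by blast
    have "word_exps (replicate x Raise @ Migrate # A) = es"
      using ge by (simp add: word_exps_raises A es map_idI)
    then show ?thesis by blast
  qed
qed

lemma MR_word_Suc:
  "MR_word (Suc k) s t =
     replicate (s (Suc k)) Migrate @ replicate (t (Suc k)) Raise @ MR_word k s t"
  by (simp add: MR_word_def)

lemma MR_word_cong:
  "(\<And>i. i \<le> k \<Longrightarrow> s i = s' i \<and> t i = t' i) \<Longrightarrow> MR_word k s t = MR_word k s' t'"
  by (auto simp: MR_word_def intro!: arg_cong[where f = concat])

text \<open>Each letter gets a block of its own, in which the exponent of the other operator is \<open>0\<close>.\<close>

lemma MR_word_surj: "\<exists>k\<ge>1. \<exists>s t. A = MR_word k s t"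
proof (induction A)
  case Nil
  have "[] = MR_word 1 (\<lambda>_. 0) (\<lambda>_. 0)" by (simp add: MR_word_def)
  then show ?case by blast
next
  case (Cons x A)
  then obtain k s t where A: "A = MR_word k s t" by blast
  define s' t' where "s' = s(Suc k := if x = Migrate then 1 else 0)"
    and "t' = t(Suc k := if x = Raise then 1 else 0)"
  have "A = MR_word k s' t'"
    unfolding A by (rule MR_word_cong) (simp add: s'_def t'_def)
  then have "x # A = MR_word (Suc k) s' t'"
    by (cases x) (simp_all add: MR_word_Suc s'_def t'_def)
  then show ?case by (intro exI[of _ "Suc k"]) auto
qed

section \<open>Numbers with a conjugate ary partition\<close>

theorem corollary3p13:
  fixes n m q :: nat
  assumes "n \<ge> 2" and "m \<ge> 2" and "q \<ge> 2"
  shows "(\<exists>\<mu>. is_partition n \<mu> \<and> conjugate_ary m q \<mu>) \<longleftrightarrow>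
    (\<exists>k\<ge>1. \<exists>s t :: nat \<Rightarrow> nat. int n = eval_mq (chi (MR_word k s t)) (int m) (int q))"
proof
  assume "\<exists>\<mu>. is_partition n \<mu> \<and> conjugate_ary m q \<mu>"
  then obtain \<mu> where n: "\<Sum>\<^sub># \<mu> = n" and conj: "conjugate_ary m q \<mu>"
    by (auto simp: is_partition_def)
  from n assms(1) have "\<mu> \<noteq> {#}" by auto
  then obtain es where es: "es \<noteq> []" "sorted_wrt (\<ge>) es" "\<mu> = staircase m q es"
    using staircase_of_conjugate_ary assms conj by blast
  then obtain A where "word_exps A = es" using word_exps_surj by blast
  with n es assms have "int n = eval_mq (chi A) (int m) (int q)" by (simp add: eval_chi)
  then show "\<exists>k\<ge>1. \<exists>s t. int n = eval_mq (chi (MR_word k s t)) (int m) (int q)"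
    using MR_word_surj[of A] by blast
next
  assume "\<exists>k\<ge>1. \<exists>s t. int n = eval_mq (chi (MR_word k s t)) (int m) (int q)"
  then obtain k s t where n: "int n = eval_mq (chi (MR_word k s t)) (int m) (int q)" by blast
  define \<mu> where "\<mu> = staircase m q (word_exps (MR_word k s t))"
  have "conjugate_ary m q \<mu>"
    unfolding \<mu>_def using assms sorted_word_exps word_exps_nonempty
    by (intro conjugate_ary_staircase)
  moreover have "is_partition n \<mu>"
    using n zero_notin_ary[OF ary_staircase assms(2)]
    unfolding is_partition_def \<mu>_def eval_chi[OF assms(2,3)] of_nat_eq_iff by blast
  ultimately show "\<exists>\<mu>. is_partition n \<mu> \<and> conjugate_ary m q \<mu>" by blast
qed

end
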